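(* If $G$ and $H$ are connected, vertex-transitive graphs, each on at least two vertices, and $\mathrm{diam}(G)+\mathrm{diam}(H)\le \chi_\rho(G)$, then the Cartesian product $G\,\square\, H$ is $\chi_\rho$-critical.
   Context: Graphs are finite, simple and undirected, with nonempty vertex set. Distance is shortest-path distance ($\infty$ between different components), and $\mathrm{diam}(G)$ is the maximum distance between pairs of vertices of $G$. For a positive integer $i$, an $i$-packing in $G$ is a set of vertices such that any two distinct vertices in it are at distance greater than $i$. The packing chromatic number $\chi_\rho(G)$ is the smallest integer $k$ such that $V(G)$ can be partitioned into (possibly empty) sets $V_1,\ldots,V_k$ with $V_i$ an $i$-packing for each $i\in\{1,\ldots,k\}$. $G-x$ denotes the graph obtained from $G$ by deleting the vertex $x$. A graph $G$ is $\chi_\rho$-critical if $\chi_\rho(G-x)<\chi_\rho(G)$ for every vertex $x$ of $G$. The Cartesian product $G\,\square\, H$ has vertex set $V(G)\times V(H)$, with $(g,h)$ and $(g',h')$ adjacent if either $gg'\in E(G)$ and $h=h'$, or $g=g'$ and $hh'\in E(H)$. A graph is vertex-transitive if its automorphism group acts transitively on its vertices. *)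

theory Defs
  imports "Graph_Theory.Graph_Theory" "HOL-Library.Disjoint_Sets"
begin

text \<open>
  A finite simple undirected graph is represented by the library's \<^locale>\<open>pair_graph\<close>: a finite,
  loop-free, symmetric digraph whose arcs are ordered pairs of vertices, so that each
  undirected edge corresponds to the two arcs \<open>(u, v)\<close> and \<open>(v, u)\<close>.
\<close>

text \<open>
  The library's weighted distance, with every arc of weight 1. It is the infimum of the lengths of
  all walks, and \<open>\<infinity>\<close> between different components.
\<close>
definition gdist :: "('a, 'b) pre_digraph \<Rightarrow> 'a \<Rightarrow> 'a \<Rightarrow> ereal" where
  "gdist G u v = wf_digraph.\<mu> G (\<lambda>_. 1) u v"

definition gdiam :: "('a, 'b) pre_digraph \<Rightarrow> ereal" where
  "gdiam G = (SUP (u, v) \<in> verts G \<times> verts G. gdist G u v)"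

definition is_packing :: "('a, 'b) pre_digraph \<Rightarrow> nat \<Rightarrow> 'a set \<Rightarrow> bool" where
  "is_packing G i S \<longleftrightarrow>
     S \<subseteq> verts G \<and> (\<forall>u\<in>S. \<forall>v\<in>S. u \<noteq> v \<longrightarrow> gdist G u v > ereal (real i))"

definition packing_partition :: "('a, 'b) pre_digraph \<Rightarrow> nat \<Rightarrow> (nat \<Rightarrow> 'a set) \<Rightarrow> bool" where
  "packing_partition G k V \<longleftrightarrow>
     (\<Union>i\<in>{1..k}. V i) = verts G \<and> disjoint_family_on V {1..k} \<and>
     (\<forall>i\<in>{1..k}. is_packing G i (V i))"

text \<open>
  The minimum exists for every finite graph (one vertex per class); the graph without vertices,
  which arises on deleting the only vertex of a one-vertex graph, gets the value 0.
\<close>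
definition packing_chromatic_number :: "('a, 'b) pre_digraph \<Rightarrow> nat" where
  "packing_chromatic_number G = (LEAST k. \<exists>V. packing_partition G k V)"

text \<open>Distances in the vertex-deleted graph are taken in that graph, not in \<open>G\<close>.\<close>
definition packing_critical :: "('a, 'b) pre_digraph \<Rightarrow> bool" where
  "packing_critical G \<longleftrightarrow>
     (\<forall>x\<in>verts G. packing_chromatic_number (pre_digraph.del_vert G x) < packing_chromatic_number G)"

definition graph_automorphism ::
    "('a, 'b) pre_digraph \<Rightarrow> ('a, 'b, 'a, 'b) digraph_isomorphism \<Rightarrow> bool" where
  "graph_automorphism G f \<longleftrightarrow> pre_digraph.digraph_isomorphism G f \<and> app_iso f G = G"

definition vertex_transitive :: "('a, 'b) pre_digraph \<Rightarrow> bool" where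
  "vertex_transitive G \<longleftrightarrow>
     (\<forall>u\<in>verts G. \<forall>v\<in>verts G. \<exists>f. graph_automorphism G f \<and> iso_verts f u = v)"

definition cartesian_product ::
    "'a pair_pre_digraph \<Rightarrow> 'c pair_pre_digraph \<Rightarrow> ('a \<times> 'c) pair_pre_digraph" where
  "cartesian_product G H =
     \<lparr> pverts = pverts G \<times> pverts H,
       parcs = {((g, h), (g', h')) | g h g' h'.
         ((g, g') \<in> parcs G \<and> h = h' \<and> h \<in> pverts H) \<or>
         (g = g' \<and> g \<in> pverts G \<and> (h, h') \<in> parcs H)} \<rparr>"

end

theory Submission
  imports Defs
begin

text \<open>
  The theorem is an instance of a criterion for a single graph. If the finite graph \<open>G\<close>
  has an embedding into itself that takes \<open>x\<close> to \<open>y\<close>, for all vertices \<open>x\<close> and \<open>y\<close>, and its diameter is at most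
  \<open>k = \<chi>\<^sub>\<rho>(G)\<close>, then \<open>G\<close> is critical: in an optimal packing colouring no two vertices
  are farther than \<open>k\<close> apart, so the last colour \<open>k\<close> occurs at exactly one vertex \<open>y\<close>. For any \<open>x\<close>,
  pulling the colouring back along an embedding with \<open>x \<mapsto> y\<close> gives an optimal colouring whose last
  class is \<open>{x}\<close>, and deleting \<open>x\<close> makes that colour superfluous
  (\<open>packing_critical_if_gdiam_le\<close>).

  Both this pull-back and the comparison of \<open>G\<close> with \<open>G \<box> H\<close> rest on one fact: an injective
  homomorphism does not increase distances, so packing colourings pull back along it
  (\<open>packing_partition_pullback\<close>). Since \<open>G\<close> embeds into \<open>G \<box> H\<close> as a layer,
  \<open>\<chi>\<^sub>\<rho>(G) \<le> \<chi>\<^sub>\<rho>(G \<box> H)\<close>; and \<open>diam(G \<box> H) \<le> diam(G) + diam(H)\<close>, because shortest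
  walks in the two factors can be run through one after the other. The hypothesis therefore bounds
  the diameter of \<open>G \<box> H\<close> by its own packing chromatic number.
\<close>

section \<open>Distances and embeddings\<close>

lemma arcs_ends_iff:
  "(u, v) \<in> arcs_ends G \<longleftrightarrow> (\<exists>e \<in> arcs G. tail G e = u \<and> head G e = v)"
  by (auto simp: arcs_ends_def arc_to_ends_def)

lemma awalk_length_iff_relpow:
  assumes "wf_digraph G"
  shows "(\<exists>p. pre_digraph.awalk G u p v \<and> length p = n)
    \<longleftrightarrow> u \<in> verts G \<and> (u, v) \<in> arcs_ends G ^^ n"
proof -
  interpret wf_digraph G by fact
  show ?thesis
  proof (induction n arbitrary: u)
    case 0
    then show ?case by (auto simp: awalk_Nil_iff)
  next
    case (Suc n)
    have "(\<exists>p. awalk u p v \<and> length p = Suc n)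
      \<longleftrightarrow> (\<exists>e p. awalk u (e # p) v \<and> length p = n)"
      unfolding length_Suc_conv by blast
    also have "\<dots> \<longleftrightarrow>
      (\<exists>e. e \<in> arcs G \<and> u = tail G e \<and> (\<exists>p. awalk (head G e) p v \<and> length p = n))"
      unfolding awalk_Cons_iff by blast
    also have "\<dots> \<longleftrightarrow> (\<exists>e. e \<in> arcs G \<and> u = tail G e \<and> (head G e, v) \<in> arcs_ends G ^^ n)"
      unfolding Suc.IH by (metis head_in_verts)
    also have "\<dots> \<longleftrightarrow> (\<exists>w. (u, w) \<in> arcs_ends G \<and> (w, v) \<in> arcs_ends G ^^ n)"
      unfolding arcs_ends_iff by blast
    also have "\<dots> \<longleftrightarrow> (u, v) \<in> arcs_ends G ^^ Suc n"
      by (blast intro: relpow_Suc_I2 dest: relpow_Suc_D2)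
    also have "\<dots> \<longleftrightarrow> u \<in> verts G \<and> (u, v) \<in> arcs_ends G ^^ Suc n"
      by (blast dest: relpow_Suc_D2 adj_in_verts(1))
    finally show ?case .
  qed
qed

lemma gdist_eq_INF_relpow:
  assumes "wf_digraph G" and "u \<in> verts G"
  shows "gdist G u v = (INF n \<in> {n. (u, v) \<in> arcs_ends G ^^ n}. ereal (real n))"
proof -
  interpret wf_digraph G by fact
  have cost: "awalk_cost (\<lambda>_. 1) p = real (length p)" for p
    by (induction p) auto
  have "length ` {p. awalk u p v} = {n. \<exists>p. awalk u p v \<and> length p = n}"
    by blast
  also have "\<dots> = {n. (u, v) \<in> arcs_ends G ^^ n}"
    unfolding awalk_length_iff_relpow[OF assms(1)] using assms(2) by simp
  finally have "length ` {p. awalk u p v} = {n. (u, v) \<in> arcs_ends G ^^ n}" .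
  moreover have "(\<lambda>p. ereal (real (length p))) ` {p. awalk u p v}
    = (\<lambda>n. ereal (real n)) ` length ` {p. awalk u p v}"
    by (simp add: image_image)
  ultimately show ?thesis
    unfolding gdist_def \<mu>_def cost by simp
qed

lemma gdist_le_relpow:
  assumes "wf_digraph G" and "u \<in> verts G" and "(u, v) \<in> arcs_ends G ^^ n"
  shows "gdist G u v \<le> ereal (real n)"
  unfolding gdist_eq_INF_relpow[OF assms(1,2)] using assms(3) by (auto intro: INF_lower)

lemma gdist_attained:
  assumes "wf_digraph G" and "u \<in> verts G" and "gdist G u v \<noteq> \<infinity>"
  obtains n where "(u, v) \<in> arcs_ends G ^^ n" and "gdist G u v = ereal (real n)"
proof -
  let ?P = "\<lambda>n. (u, v) \<in> arcs_ends G ^^ n"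
  have ex: "\<exists>n. ?P n"
  proof (rule ccontr)
    assume "\<nexists>n. ?P n"
    then have "gdist G u v = \<infinity>"
      unfolding gdist_eq_INF_relpow[OF assms(1,2)] by (simp add: top_ereal_def)
    with assms(3) show False ..
  qed
  let ?n = "LEAST n. ?P n"
  have "?P ?n" using ex by (rule LeastI_ex)
  moreover have "gdist G u v = ereal (real ?n)"
  proof (rule antisym)
    show "gdist G u v \<le> ereal (real ?n)"
      using gdist_le_relpow[OF assms(1,2)] \<open>?P ?n\<close> by blast
    show "ereal (real ?n) \<le> gdist G u v"
      unfolding gdist_eq_INF_relpow[OF assms(1,2)]
      by (rule INF_greatest) (auto intro: Least_le)
  qed
  ultimately show ?thesis by (rule that)
qed

lemma relpow_map:
  assumes "\<And>x y. (x, y) \<in> R \<Longrightarrow> (f x, f y) \<in> S" and "(x, y) \<in> R ^^ n"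
  shows "(f x, f y) \<in> S ^^ n"
  using assms(2) by (induction n arbitrary: y) (auto intro: assms(1))

text \<open>
  The image need not be an induced subgraph: additional arcs of \<open>B\<close> only shorten distances there,
  and an upper bound on the distances in \<open>B\<close> is all that pulling back packings requires.
\<close>
definition graph_embedding ::
    "('a, 'b) pre_digraph \<Rightarrow> ('c, 'd) pre_digraph \<Rightarrow> ('a \<Rightarrow> 'c) \<Rightarrow> bool" where
  "graph_embedding A B f \<longleftrightarrow>
     inj_on f (verts A) \<and> f ` verts A \<subseteq> verts B \<and>
     (\<forall>u v. (u, v) \<in> arcs_ends A \<longrightarrow> (f u, f v) \<in> arcs_ends B)"

lemma gdist_graph_embedding_le:
  assumes "wf_digraph A" and "wf_digraph B" and f: "graph_embedding A B f" and u: "u \<in> verts A"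
  shows "gdist B (f u) (f v) \<le> gdist A u v"
proof (cases "gdist A u v = \<infinity>")
  case False
  then obtain n where n: "(u, v) \<in> arcs_ends A ^^ n" "gdist A u v = ereal (real n)"
    using gdist_attained[OF assms(1) u] by blast
  have "(f u, f v) \<in> arcs_ends B ^^ n"
    by (rule relpow_map[OF _ n(1)]) (use f in \<open>simp add: graph_embedding_def\<close>)
  then show ?thesis
    using gdist_le_relpow[OF assms(2)] f u n(2) by (auto simp: graph_embedding_def)
qed simp

section \<open>Packing colourings\<close>

text \<open>
  If the image avoids the classes beyond \<open>j\<close>, these colours are dropped. The case \<open>j = k\<close> compares
  packing chromatic numbers; \<open>j = k - 1\<close> saves a colour after deletion of a vertex.
\<close>
lemma packing_partition_pullback:
  assumes "wf_digraph A" and "wf_digraph B" and f: "graph_embedding A B f"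
    and V: "packing_partition B k V" and "j \<le> k"
    and cover: "f ` verts A \<subseteq> (\<Union>i\<in>{1..j}. V i)"
  shows "packing_partition A j (\<lambda>i. {u \<in> verts A. f u \<in> V i})"
  unfolding packing_partition_def
proof (intro conjI ballI)
  show "(\<Union>i\<in>{1..j}. {u \<in> verts A. f u \<in> V i}) = verts A"
    using cover by blast
  have "{1..j} \<subseteq> {1..k}" using \<open>j \<le> k\<close> by auto
  then have "disjoint_family_on V {1..j}"
    by (rule disjoint_family_on_mono) (use V in \<open>simp add: packing_partition_def\<close>)
  then show "disjoint_family_on (\<lambda>i. {u \<in> verts A. f u \<in> V i}) {1..j}"
    by (simp add: disjoint_family_on_def disjoint_iff)
  fix i assume "i \<in> {1..j}"
  then have pack: "is_packing B i (V i)"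
    using V \<open>j \<le> k\<close> by (auto simp: packing_partition_def)
  show "is_packing A i {u \<in> verts A. f u \<in> V i}"
    unfolding is_packing_def
  proof (intro conjI ballI impI)
    fix u v assume uv: "u \<in> {u \<in> verts A. f u \<in> V i}" "v \<in> {u \<in> verts A. f u \<in> V i}" "u \<noteq> v"
    then have "f u \<noteq> f v"
      using f by (auto simp: graph_embedding_def inj_on_def)
    then have "ereal (real i) < gdist B (f u) (f v)"
      using pack uv(1,2) by (simp add: is_packing_def)
    also have "\<dots> \<le> gdist A u v"
      by (rule gdist_graph_embedding_le[OF assms(1,2) f]) (use uv in simp)
    finally show "ereal (real i) < gdist A u v" .
  qed auto
qed

lemma packing_chromatic_number_le:
  "packing_partition G k V \<Longrightarrow> packing_chromatic_number G \<le> k"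
  unfolding packing_chromatic_number_def by (rule Least_le) blast

lemma optimal_packing_partition:
  assumes "finite (verts G)"
  obtains V where "packing_partition G (packing_chromatic_number G) V"
proof -
  obtain h where h: "bij_betw h {1..card (verts G)} (verts G)"
    using ex_bij_betw_nat_finite_1[OF assms] by blast
  have inj: "inj_on h {1..card (verts G)}" and img: "h ` {1..card (verts G)} = verts G"
    using h by (simp_all add: bij_betw_def)
  have "disjoint_family_on (\<lambda>i. {h i}) {1..card (verts G)}"
    using inj unfolding disjoint_family_on_def inj_on_def by blast
  moreover have "(\<Union>i\<in>{1..card (verts G)}. {h i}) = verts G"
    using img by blast
  moreover have "is_packing G i {h i}" if "i \<in> {1..card (verts G)}" for i
    using img that by (auto simp: is_packing_def)
  ultimately have "packing_partition G (card (verts G)) (\<lambda>i. {h i})"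
    by (simp add: packing_partition_def)
  then have "\<exists>k V. packing_partition G k V" by blast
  then have "\<exists>V. packing_partition G (packing_chromatic_number G) V"
    unfolding packing_chromatic_number_def by (rule LeastI_ex)
  then show ?thesis using that by blast
qed

lemma packing_chromatic_number_mono:
  assumes "wf_digraph A" and "wf_digraph B" and "finite (verts B)" and f: "graph_embedding A B f"
  shows "packing_chromatic_number A \<le> packing_chromatic_number B"
proof -
  obtain V where V: "packing_partition B (packing_chromatic_number B) V"
    using optimal_packing_partition[OF assms(3)] .
  have "f ` verts A \<subseteq> (\<Union>i\<in>{1..packing_chromatic_number B}. V i)"
    using f V by (auto simp: graph_embedding_def packing_partition_def)
  then show ?thesis
    by (rule packing_chromatic_number_le[OF packing_partition_pullback[OF assms(1,2) f V order_refl]])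
qed

lemma gdist_le_gdiam: "u \<in> verts G \<Longrightarrow> v \<in> verts G \<Longrightarrow> gdist G u v \<le> gdiam G"
  unfolding gdiam_def by (rule SUP_upper2[of "(u, v)"]) auto

text \<open>
  When the diameter does not exceed the packing chromatic number, the last colour of an optimal
  colouring occurs exactly once: at least once by optimality, and not twice because two vertices
  would have to be farther apart than the diameter.
\<close>
lemma last_class_singleton:
  assumes "verts G \<noteq> {}" and V: "packing_partition G (packing_chromatic_number G) V"
    and diam: "gdiam G \<le> ereal (real (packing_chromatic_number G))"
  obtains n y where "packing_chromatic_number G = Suc n" and "V (Suc n) = {y}"
proof -
  have "packing_chromatic_number G \<noteq> 0"
    using assms(1) V by (auto simp: packing_partition_def)
  then obtain n where k: "packing_chromatic_number G = Suc n"
    using not0_implies_Suc by blast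
  have "V (Suc n) \<noteq> {}"
  proof
    assume empty: "V (Suc n) = {}"
    have "packing_partition G n V"
      using V empty unfolding k packing_partition_def disjoint_family_on_def
      by (auto simp: atLeastAtMostSuc_conv)
    then show False
      using packing_chromatic_number_le[of G n V] k by simp
  qed
  then obtain y where y: "y \<in> V (Suc n)" by blast
  have pack: "is_packing G (Suc n) (V (Suc n))"
    using V unfolding k packing_partition_def by simp
  have "z = y" if z: "z \<in> V (Suc n)" for z
  proof (rule ccontr)
    assume "z \<noteq> y"
    then have "ereal (real (Suc n)) < gdist G z y"
      using pack y z by (simp add: is_packing_def)
    moreover have "gdist G z y \<le> gdiam G"
      using pack y z by (intro gdist_le_gdiam) (auto simp: is_packing_def)
    ultimately show False
      using diam unfolding k by simp
  qed
  then have "V (Suc n) = {y}" using y by blast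
  with k show ?thesis by (rule that)
qed

lemma packing_critical_if_gdiam_le:
  assumes wf: "wf_digraph G" and fin: "finite (verts G)"
    and trans: "\<And>x y. x \<in> verts G \<Longrightarrow> y \<in> verts G \<Longrightarrow> \<exists>f. graph_embedding G G f \<and> f x = y"
    and diam: "gdiam G \<le> ereal (real (packing_chromatic_number G))"
  shows "packing_critical G"
  unfolding packing_critical_def
proof
  fix x assume x: "x \<in> verts G"
  obtain V where V: "packing_partition G (packing_chromatic_number G) V"
    using optimal_packing_partition[OF fin] .
  obtain n y where k: "packing_chromatic_number G = Suc n" and y: "V (Suc n) = {y}"
    using last_class_singleton[OF _ V diam] x by blast
  have cover: "(\<Union>i\<in>{1..n}. V i) \<union> {y} = verts G"
    using V y unfolding k packing_partition_def by (auto simp: atLeastAtMostSuc_conv)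
  then obtain f where f: "graph_embedding G G f" and fx: "f x = y"
    using trans x by blast
  let ?D = "pre_digraph.del_vert G x"
  have wfD: "wf_digraph ?D"
    using wf by (rule wf_digraph.wf_digraph_del_vert)
  have fD: "graph_embedding ?D G f"
    using f unfolding graph_embedding_def
    by (auto simp: pre_digraph.del_vert_simps arcs_ends_def arc_to_ends_def inj_on_def)
  have "f ` verts ?D \<subseteq> verts G - {y}"
    using f fx x unfolding graph_embedding_def
    by (auto simp: pre_digraph.del_vert_simps inj_on_def)
  then have "f ` verts ?D \<subseteq> (\<Union>i\<in>{1..n}. V i)"
    using cover by blast
  then have "packing_chromatic_number ?D \<le> n"
    by (intro packing_chromatic_number_le[OF packing_partition_pullback[OF wfD wf fD V]])
      (simp add: k)
  then show "packing_chromatic_number ?D < packing_chromatic_number G"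
    using k by simp
qed

section \<open>Cartesian products\<close>

lemma verts_cartesian_product [simp]:
  "pverts (cartesian_product G H) = pverts G \<times> pverts H"
  by (simp add: cartesian_product_def)

lemma arcs_cartesian_product_iff [simp]:
  "((g, h), (g', h')) \<in> parcs (cartesian_product G H) \<longleftrightarrow>
     (g, g') \<in> parcs G \<and> h = h' \<and> h \<in> pverts H \<or> g = g' \<and> g \<in> pverts G \<and> (h, h') \<in> parcs H"
  by (auto simp: cartesian_product_def)

lemma wf_digraph_cartesian_product:
  assumes "pair_wf_digraph G" and "pair_wf_digraph H"
  shows "wf_digraph (with_proj (cartesian_product G H))"
proof -
  interpret G: pair_wf_digraph G by fact
  interpret H: pair_wf_digraph H by fact
  show ?thesis
    by unfold_locales (auto dest: G.wellformed' H.wellformed')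
qed

lemma graph_embedding_layer:
  assumes "h \<in> pverts H"
  shows "graph_embedding (with_proj G) (with_proj (cartesian_product G H)) (\<lambda>g. (g, h))"
  using assms by (auto simp: graph_embedding_def inj_on_def)

lemma graph_embedding_map_prod:
  assumes "graph_embedding (with_proj G) (with_proj G) a"
    and "graph_embedding (with_proj H) (with_proj H) b"
  shows "graph_embedding (with_proj (cartesian_product G H))
    (with_proj (cartesian_product G H)) (map_prod a b)"
  using assms by (auto simp: graph_embedding_def inj_on_def)

lemma gdist_cartesian_product_le:
  assumes "pair_wf_digraph G" and "pair_wf_digraph H"
    and g: "g \<in> pverts G" "g' \<in> pverts G" and h: "h \<in> pverts H" "h' \<in> pverts H"
  shows "gdist (with_proj (cartesian_product G H)) (g, h) (g', h')
    \<le> gdist (with_proj G) g g' + gdist (with_proj H) h h'"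
proof (cases "gdist (with_proj G) g g' = \<infinity> \<or> gdist (with_proj H) h h' = \<infinity>")
  case True
  then show ?thesis by auto
next
  case False
  have wfG: "wf_digraph (with_proj G)" and wfH: "wf_digraph (with_proj H)"
    using assms(1,2) by (simp_all add: wf_digraph_wp_iff)
  obtain m where m: "(g, g') \<in> parcs G ^^ m" "gdist (with_proj G) g g' = ereal (real m)"
    using gdist_attained[OF wfG, of g g'] False g by auto
  obtain n where n: "(h, h') \<in> parcs H ^^ n" "gdist (with_proj H) h h' = ereal (real n)"
    using gdist_attained[OF wfH, of h h'] False h by auto
  let ?E = "parcs (cartesian_product G H)"
  have "((g, h), (g', h)) \<in> ?E ^^ m"
    by (rule relpow_map[where R = "parcs G" and f = "\<lambda>g. (g, h)"]) (use h m in auto)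
  moreover have "((g', h), (g', h')) \<in> ?E ^^ n"
    by (rule relpow_map[where R = "parcs H" and f = "\<lambda>h. (g', h)"]) (use g n in auto)
  ultimately have "((g, h), (g', h')) \<in> ?E ^^ (m + n)"
    by (auto simp: relpow_add)
  then have "gdist (with_proj (cartesian_product G H)) (g, h) (g', h') \<le> ereal (real (m + n))"
    using g h by (intro gdist_le_relpow wf_digraph_cartesian_product assms) auto
  then show ?thesis
    using m n by simp
qed

lemma gdiam_cartesian_product_le:
  assumes "pair_wf_digraph G" and "pair_wf_digraph H"
  shows "gdiam (with_proj (cartesian_product G H)) \<le> gdiam (with_proj G) + gdiam (with_proj H)"
proof -
  have "gdist (with_proj (cartesian_product G H)) (g, h) (g', h')
      \<le> gdiam (with_proj G) + gdiam (with_proj H)"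
    if "g \<in> pverts G" "g' \<in> pverts G" "h \<in> pverts H" "h' \<in> pverts H" for g g' h h'
    by (rule order_trans[OF gdist_cartesian_product_le[OF assms that]])
      (use that in \<open>auto intro!: add_mono gdist_le_gdiam\<close>)
  then show ?thesis
    unfolding gdiam_def[of "with_proj (cartesian_product G H)"]
    by (auto intro!: SUP_least)
qed

section \<open>Criticality of the product\<close>

lemma graph_embedding_automorphism:
  assumes "graph_automorphism G f"
  shows "graph_embedding G G (iso_verts f)"
proof -
  have iso: "pre_digraph.digraph_isomorphism G f" and app: "app_iso f G = G"
    using assms by (auto simp: graph_automorphism_def)
  have eqs: "iso_verts f ` verts G = verts G" "iso_arcs f ` arcs G = arcs G"
      "iso_tail f = tail G" "iso_head f = head G"
    using app by (metis app_iso_simps)+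
  have "(iso_verts f u, iso_verts f v) \<in> arcs_ends G" if uv: "(u, v) \<in> arcs_ends G" for u v
  proof -
    obtain e where e: "e \<in> arcs G" "tail G e = u" "head G e = v"
      using uv by (auto simp: arcs_ends_def arc_to_ends_def)
    have "tail G (iso_arcs f e) = iso_verts f u" "head G (iso_arcs f e) = iso_verts f v"
      using iso e eqs(3,4) by (auto simp: pre_digraph.digraph_isomorphism_def)
    moreover have "iso_arcs f e \<in> arcs G" using e(1) eqs(2) by blast
    ultimately show ?thesis
      by (force simp: arcs_ends_def arc_to_ends_def)
  qed
  then show ?thesis
    using iso eqs(1) by (simp add: graph_embedding_def pre_digraph.digraph_isomorphism_def)
qed

lemma vertex_transitive_embedding:
  assumes "vertex_transitive G" and "u \<in> verts G" and "v \<in> verts G"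
  obtains f where "graph_embedding G G f" and "f u = v"
  using assms graph_embedding_automorphism unfolding vertex_transitive_def by blast

theorem theorem6p3:
  fixes G :: "'a pair_pre_digraph" and H :: "'c pair_pre_digraph"
  assumes "pair_graph G" and "pair_graph H"
    and "Digraph_Component.connected (with_proj G)"
    and "Digraph_Component.connected (with_proj H)"
    and "vertex_transitive (with_proj G)" and "vertex_transitive (with_proj H)"
    and "card (pverts G) \<ge> 2" and "card (pverts H) \<ge> 2"
    and "gdiam (with_proj G) + gdiam (with_proj H)
           \<le> ereal (real (packing_chromatic_number (with_proj G)))"
  shows "packing_critical (with_proj (cartesian_product G H))"
proof -
  interpret G: pair_graph G by fact
  interpret H: pair_graph H by fact
  let ?P = "with_proj (cartesian_product G H)"
  have wf: "wf_digraph ?P"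
    by (rule wf_digraph_cartesian_product) unfold_locales
  have fin: "finite (verts ?P)"
    using G.pair_finite_verts H.pair_finite_verts by simp
  obtain h where h: "h \<in> pverts H"
    using assms(8) by fastforce
  show ?thesis
  proof (rule packing_critical_if_gdiam_le[OF wf fin])
    fix x y assume "x \<in> verts ?P" "y \<in> verts ?P"
    then have x: "fst x \<in> pverts G" "snd x \<in> pverts H"
      and y: "fst y \<in> pverts G" "snd y \<in> pverts H" by auto
    obtain a where a: "graph_embedding (with_proj G) (with_proj G) a" "a (fst x) = fst y"
      using vertex_transitive_embedding[OF assms(5), of "fst x" "fst y"] x y by auto
    obtain b where b: "graph_embedding (with_proj H) (with_proj H) b" "b (snd x) = snd y"
      using vertex_transitive_embedding[OF assms(6), of "snd x" "snd y"] x y by auto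
    have "map_prod a b x = y"
      using a(2) b(2) by (simp add: prod_eq_iff)
    then show "\<exists>f. graph_embedding ?P ?P f \<and> f x = y"
      using graph_embedding_map_prod[OF a(1) b(1)] by blast
  next
    have "gdiam ?P \<le> gdiam (with_proj G) + gdiam (with_proj H)"
      by (rule gdiam_cartesian_product_le) unfold_locales
    also have "\<dots> \<le> ereal (real (packing_chromatic_number (with_proj G)))"
      by fact
    also have "\<dots> \<le> ereal (real (packing_chromatic_number ?P))"
      using packing_chromatic_number_mono[OF _ wf fin graph_embedding_layer[OF h]]
        G.wf_digraph_axioms by simp
    finally show "gdiam ?P \<le> ereal (real (packing_chromatic_number ?P))" .
  qed
qed

end
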